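(* Suppose that: (A1) the functions $f_1,\dots,f_N:\mathbb{R}^n\to\mathbb{R}$ are bounded from below and twice continuously differentiable with $L$-Lipschitz-continuous gradients; (A4) the sampling is (possibly) nonuniform as described in the context, and there exist constants $M_3\ge0$ and $\varepsilon>0$ such that the sampling probabilities satisfy $|p_j^k-\frac1N|\le\frac{M_3}{k^{\varepsilon}}$ for $j=1,\dots,N$ and every $k\ge1$ at which a new subsample is drawn; (A5) there exist constants $M_1$ and $M_2$ such that $\|\nabla f_i(x)\|\le M_1+M_2\|\nabla f(x)\|$ for every $x\in\mathbb{R}^n$ and every $i\in\{1,\dots,N\}$. Let $\{x_k\}$ be a sequence generated by the modified SLiSeS algorithm described in the context. Then, with probability 1, $$\liminf_{k\to\infty}\|\nabla f(x_k)\|=0.$$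
   Context: Problem: minimize $f(x)=\frac1N\sum_{i=1}^N f_i(x)$ over $x\in\mathbb{R}^n$. Let $\mathcal{N}=\{1,\dots,N\}$. For a subsample $\mathcal{N}_k=\{i_1^k,\dots,i_S^k\}$ of $S$ indices from $\mathcal{N}$ (repetitions counted), set $f_{\mathcal{N}_k}(x)=\frac1S\sum_{j=1}^S f_{i_j^k}(x)$ and $\nabla f_{\mathcal{N}_k}(x)=\frac1S\sum_{j=1}^S\nabla f_{i_j^k}(x)$. Modified SLiSeS algorithm. Input: $x_0\in\mathbb{R}^n$, $\eta\in(0,1)$, $S\in\{1,\dots,N\}$, a positive integer $m$, constants $0<\gamma_{\min}\le1\le\gamma_{\max}<\infty$, $\delta>0$ (arbitrarily small), $\tilde\gamma>0$, nonnegative numbers $t_k$ with $\sum_k t_k\le\bar t<\infty$. For $k=0,1,2,\dots$: (S1) If $k$ is a multiple of $m$, draw a new random subsample $\mathcal{N}_k$ of size $S$; otherwise $\mathcal{N}_k=\mathcal{N}_{k-1}$. (S2) $g_k=\nabla f_{\mathcal{N}_k}(x_k)$. (S3') If $k$ is a multiple of $m$, set $\gamma_k=\tilde\gamma/\max\{k,1\}$ and go to (S5'). Otherwise set $s_{k-1}=x_k-x_{k-1}$, $y_{k-1}=g_k-g_{k-1}$, $c_k=\|s_{k-1}\|^2/(s_{k-1}^Ty_{k-1})$ (with $c_k=1$ if this is undefined) and go to (S4'). (S4') $\gamma_k=\min\{\gamma_{\max},\max\{\gamma_{\min},c_k\}\}/k^{1+\delta}$. (S5') $d_k=-\gamma_k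 g_k$. If $k$ is a multiple of $m$, set $\alpha_k=1$ and go to (S7); otherwise go to (S6). (S6) Find $\alpha_k\in(0,1]$ with $f_{\mathcal{N}_k}(x_k+\alpha_kd_k)\le f_{\mathcal{N}_k}(x_k)+\eta\alpha_k d_k^T\nabla f_{\mathcal{N}_k}(x_k)+t_k$ by the procedure LSP below. (S7) $x_{k+1}=x_k+\alpha_kd_k$. LSP at iteration $k$: put $dm_k=g_k^Td_k$. Start with trial step $\alpha=1$ and repeat the following. If $f_{\mathcal{N}_k}(x_k+\alpha d_k)\le f_{\mathcal{N}_k}(x_k)+\eta\alpha\, dm_k+t_k$, stop with $\alpha_k=\alpha$. Otherwise: - if $\alpha>0.1$, compute $\tilde\alpha=\dfrac{-dm_k\,\alpha^2}{2\,(f_{\mathcal{N}_k}(x_k+\alpha d_k)-f_{\mathcal{N}_k}(x_k)-\alpha\, dm_k)}$; if $\tilde\alpha<0.1\alpha$ or $\tilde\alpha>0.9\alpha$, replace $\tilde\alpha$ by $\alpha/2$; then set $\alpha:=\tilde\alpha$; - if $\alpha\le0.1$, set $\alpha:=\alpha/2$. $\mathcal{F}_k$ is the $\sigma$-algebra generated by $\mathcal{N}_0,\dots,\mathcal{N}_{k-1}$. Nonuniform sampling: at each $k$ that is a multiple of $m$, the indices $i_1^k,\dots,i_S^k$ are, conditionally on $\mathcal{F}_k$, i.i.d. random elements of $\{1,\dots,N\}$ with $P(i_\ell^k=j\mid\mathcal{F}_k)=p_j^k$, $j=1,\dots,N$, where the probabilities $p_j^k$ may depend on the past (they are $\mathcal{F}_k$-measurable).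 *)

theory Defs
  imports "HOL-Probability.Probability"
begin

definition gradient :: "('a::real_inner \<Rightarrow> real) \<Rightarrow> 'a \<Rightarrow> 'a" where
  "gradient f x = (THE D. GDERIV f x :> D)"

definition twice_continuously_differentiable :: "('a::real_normed_vector \<Rightarrow> real) \<Rightarrow> bool" where
  "twice_continuously_differentiable f \<longleftrightarrow>
     (\<exists>(f' :: 'a \<Rightarrow> 'a \<Rightarrow>\<^sub>L real) (f'' :: 'a \<Rightarrow> 'a \<Rightarrow>\<^sub>L 'a \<Rightarrow>\<^sub>L real).
        (\<forall>x. (f has_derivative blinfun_apply (f' x)) (at x)) \<and>
        (\<forall>x. (f' has_derivative blinfun_apply (f'' x)) (at x)) \<and>
        continuous_on UNIV f'')"

definition full_objective :: "nat \<Rightarrow> (nat \<Rightarrow> 'a \<Rightarrow> real) \<Rightarrow> 'a \<Rightarrow> real" where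
  "full_objective N f x = (1 / real N) * (\<Sum>i=1..N. f i x)"

text \<open>A subsample is given by the index sequence \<open>i 1, \<dots>, i S\<close>, so repetitions are counted;
  values \<open>i l\<close> with \<open>l\<close> outside \<open>{1..S}\<close> are irrelevant.\<close>

definition sub_objective ::
    "(nat \<Rightarrow> 'a \<Rightarrow> real) \<Rightarrow> nat \<Rightarrow> (nat \<Rightarrow> nat) \<Rightarrow> 'a \<Rightarrow> real" where
  "sub_objective f S i x = (1 / real S) * (\<Sum>l=1..S. f (i l) x)"

definition sub_gradient ::
    "(nat \<Rightarrow> 'a::real_inner \<Rightarrow> real) \<Rightarrow> nat \<Rightarrow> (nat \<Rightarrow> nat) \<Rightarrow> 'a \<Rightarrow> 'a" where
  "sub_gradient f S i x = (1 / real S) *\<^sub>R (\<Sum>l=1..S. gradient (f (i l)) x)"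


section \<open>The line search\<close>

text \<open>In this section \<open>F\<close> is the sampled function, \<open>x\<close> the current point, \<open>d\<close> the search direction,
  \<open>dm\<close> the inner product of the sampled gradient with \<open>d\<close>, and \<open>\<tau>\<close> the nonmonotonicity term.\<close>

definition ls_accept ::
    "('a::real_vector \<Rightarrow> real) \<Rightarrow> 'a \<Rightarrow> 'a \<Rightarrow> real \<Rightarrow> real \<Rightarrow> real \<Rightarrow> real \<Rightarrow> bool" where
  "ls_accept F x d dm \<eta> \<tau> \<alpha> \<longleftrightarrow> F (x + \<alpha> *\<^sub>R d) \<le> F x + \<eta> * \<alpha> * dm + \<tau>"

definition ls_next :: "('a::real_vector \<Rightarrow> real) \<Rightarrow> 'a \<Rightarrow> 'a \<Rightarrow> real \<Rightarrow> real \<Rightarrow> real" where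
  "ls_next F x d dm \<alpha> =
     (if \<alpha> > 0.1
      then let \<beta> = - dm * \<alpha>\<^sup>2 / (2 * (F (x + \<alpha> *\<^sub>R d) - F x - \<alpha> * dm))
           in if \<beta> < 0.1 * \<alpha> \<or> \<beta> > 0.9 * \<alpha> then \<alpha> / 2 else \<beta>
      else \<alpha> / 2)"

definition ls_trial :: "('a::real_vector \<Rightarrow> real) \<Rightarrow> 'a \<Rightarrow> 'a \<Rightarrow> real \<Rightarrow> nat \<Rightarrow> real" where
  "ls_trial F x d dm j = (ls_next F x d dm ^^ j) 1"

text \<open>The procedure terminates and returns \<open>\<alpha>\<close>, the first accepted trial step.\<close>

definition ls_returns ::
    "('a::real_vector \<Rightarrow> real) \<Rightarrow> 'a \<Rightarrow> 'a \<Rightarrow> real \<Rightarrow> real \<Rightarrow> real \<Rightarrow> real \<Rightarrow> bool" where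
  "ls_returns F x d dm \<eta> \<tau> \<alpha> \<longleftrightarrow>
     (\<exists>j. ls_accept F x d dm \<eta> \<tau> (ls_trial F x d dm j) \<and>
          (\<forall>i<j. \<not> ls_accept F x d dm \<eta> \<tau> (ls_trial F x d dm i)) \<and>
          \<alpha> = ls_trial F x d dm j)"


section \<open>The modified SLiSeS algorithm\<close>

definition spectral_coeff :: "'a::real_inner \<Rightarrow> 'a \<Rightarrow> real" where
  "spectral_coeff s y = (if s \<bullet> y = 0 then 1 else (norm s)\<^sup>2 / (s \<bullet> y))"

text \<open>One run of the algorithm along a given sequence of subsamples, \<open>i k\<close> being the
  \<open>k\<close>-th one; \<open>\<gamma>0\<close> is the constant used at the iterations that are multiples of \<open>m\<close>.\<close>

definition slises_run ::
    "(nat \<Rightarrow> 'a::real_inner \<Rightarrow> real) \<Rightarrow> nat \<Rightarrow> nat \<Rightarrow> 'a \<Rightarrow> real \<Rightarrow> real \<Rightarrow> real \<Rightarrow> real \<Rightarrow> real \<Rightarrow>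
     (nat \<Rightarrow> real) \<Rightarrow> (nat \<Rightarrow> nat \<Rightarrow> nat) \<Rightarrow> (nat \<Rightarrow> 'a) \<Rightarrow> bool" where
  "slises_run f S m x0 \<eta> \<gamma>min \<gamma>max \<delta> \<gamma>0 t i x \<longleftrightarrow>
     x 0 = x0 \<and>
     (\<exists>g \<gamma> d \<alpha>. \<forall>k.
        (\<not> m dvd k \<longrightarrow> (\<forall>l\<in>{1..S}. i k l = i (k - 1) l)) \<and>
        g k = sub_gradient f S (i k) (x k) \<and>
        \<gamma> k = (if m dvd k then \<gamma>0 / real (max k 1)
               else min \<gamma>max (max \<gamma>min (spectral_coeff (x k - x (k - 1)) (g k - g (k - 1))))
                      / real k powr (1 + \<delta>)) \<and>
        d k = - (\<gamma> k *\<^sub>R g k) \<and>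
        (if m dvd k then \<alpha> k = 1
         else ls_returns (sub_objective f S (i k)) (x k) (d k) (g k \<bullet> d k) \<eta> (t k) (\<alpha> k)) \<and>
        x (Suc k) = x k + \<alpha> k *\<^sub>R d k)"


section \<open>Nonuniform sampling\<close>

text \<open>\<open>i k l \<omega>\<close> is the \<open>l\<close>-th index of the \<open>k\<close>-th subsample.\<close>

definition history ::
    "'w measure \<Rightarrow> nat \<Rightarrow> nat \<Rightarrow> (nat \<Rightarrow> nat \<Rightarrow> 'w \<Rightarrow> nat) \<Rightarrow> nat \<Rightarrow> 'w measure" where
  "history M N S i k =
     sigma (space M) (\<Union>k'<k. \<Union>l\<in>{1..S}. {i k' l -` A \<inter> space M | A. A \<subseteq> {1..N}})"

definition conditional_probability :: "'w measure \<Rightarrow> 'w measure \<Rightarrow> 'w set \<Rightarrow> 'w \<Rightarrow> real" where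
  "conditional_probability M F A = real_cond_exp M F (indicator A)"

definition conditionally_indep_vars ::
    "'w measure \<Rightarrow> 'w measure \<Rightarrow> ('i \<Rightarrow> 'b measure) \<Rightarrow> ('i \<Rightarrow> 'w \<Rightarrow> 'b) \<Rightarrow> 'i set \<Rightarrow> bool" where
  "conditionally_indep_vars M F M' X I \<longleftrightarrow>
     (\<forall>l\<in>I. X l \<in> measurable M (M' l)) \<and>
     (\<forall>J A. J \<subseteq> I \<and> finite J \<and> J \<noteq> {} \<and> (\<forall>l\<in>J. A l \<in> sets (M' l)) \<longrightarrow>
        (AE \<omega> in M. conditional_probability M F (\<Inter>l\<in>J. X l -` A l \<inter> space M) \<omega> =
                    (\<Prod>l\<in>J. conditional_probability M F (X l -` A l \<inter> space M) \<omega>)))"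

text \<open>\<open>p k j\<close> is the conditional probability of drawing index \<open>j\<close> at iteration \<open>k\<close>. It is
  nonnegative and sums to one over \<open>j\<close> almost surely, as a consequence of the last but one
  condition.\<close>

definition nonuniform_sampling ::
    "'w measure \<Rightarrow> nat \<Rightarrow> nat \<Rightarrow> nat \<Rightarrow> (nat \<Rightarrow> nat \<Rightarrow> 'w \<Rightarrow> nat) \<Rightarrow> (nat \<Rightarrow> nat \<Rightarrow> 'w \<Rightarrow> real) \<Rightarrow> bool"
  where
  "nonuniform_sampling M N S m i p \<longleftrightarrow>
     (\<forall>k. \<forall>l\<in>{1..S}. i k l \<in> measurable M (count_space {1..N})) \<and>
     (\<forall>k. m dvd k \<longrightarrow>
        (\<forall>j\<in>{1..N}. p k j \<in> borel_measurable (history M N S i k)) \<and>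
        (\<forall>l\<in>{1..S}. \<forall>j\<in>{1..N}. AE \<omega> in M.
            conditional_probability M (history M N S i k) (i k l -` {j} \<inter> space M) \<omega> = p k j \<omega>) \<and>
        conditionally_indep_vars M (history M N S i k) (\<lambda>_. count_space {1..N}) (i k) {1..S})"

end

theory Submission
  imports Defs
begin

text \<open>
  Let \<open>F\<close> be the full objective, bounded below by \<open>c\<close>, and let \<open>V = F - c\<close>. The proof shows that
  the expectation \<open>u k\<close> of \<open>V (x k)\<close> nearly decreases, and that the decrease at a sampling iteration,
  that is, at a multiple of \<open>m\<close>, is about \<open>\<gamma>0 / k\<close> times the expected squared gradient norm.

  For a function with Lipschitz gradient that is bounded below, the squared gradient norm is at most
  a multiple of \<open>V\<close> (\<open>gradient_norm_le_gap\<close>). Together with the growth bound on the individual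
  gradients, every error made in one step is therefore at most a multiple of \<open>1 + V\<close>
  (\<open>inexact_gradient_step\<close>). It remains to see that the factors are summable.

  At a line search iteration, the step length is at most a multiple of \<open>1 / k powr (1 + \<delta>)\<close>
  (\<open>slises_run_step\<close>), so the whole step counts as an error. At a sampling iteration, the step length is
  \<open>\<gamma>0 / k\<close>. The second order error has a factor \<open>1 / k\<^sup>2\<close>. The first order term needs the expectation:
  the iterate is determined by the earlier samples (\<open>slises_run_determined\<close>), so drawing a new one gives an
  almost unbiased estimate of the gradient, with a bias of order \<open>1 / k powr \<epsilon>\<close>
  (\<open>sub_gradient_nearly_unbiased\<close>). This produces the decrease and an error with factor
  \<open>1 / k powr (1 + \<epsilon>)\<close>.

  All factors being deterministic, it is enough to take expectations: the recursion for the numbers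
  \<open>u k\<close> (\<open>perturbed_descent_summable\<close>) shows that the expected decreases are summable, without any
  martingale convergence theorem. Then almost surely the sum of \<open>(norm (D (x k)))\<^sup>2 / k\<close> over the multiples
  \<open>k\<close> of \<open>m\<close>, where \<open>D\<close> is the gradient of \<open>F\<close>, is finite. As the harmonic series diverges, the
  gradient norms cannot stay away from 0.
\<close>

section \<open>Gradients and the decrease along an inexact gradient step\<close>

lemma gradient_eqI:
  assumes "GDERIV F x :> D"
  shows "gradient F x = D"
  unfolding gradient_def
proof (rule the_equality)
  show "GDERIV F x :> D" by (fact assms)
next
  fix D' assume "GDERIV F x :> D'"
  then have "(\<lambda>h. h \<bullet> D') = (\<lambda>h. h \<bullet> D)"
    using assms unfolding gderiv_def by (rule has_derivative_unique)
  then show "D' = D"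
    by (metis vector_eq_rdot inner_commute)
qed

lemma C2_imp_GDERIV_gradient:
  fixes F :: "'a::euclidean_space \<Rightarrow> real"
  assumes "twice_continuously_differentiable F"
  shows "GDERIV F x :> gradient F x"
proof -
  obtain F' :: "'a \<Rightarrow> 'a \<Rightarrow>\<^sub>L real" where F': "(F has_derivative blinfun_apply (F' x)) (at x)"
    using assms unfolding twice_continuously_differentiable_def by blast
  have "linear (blinfun_apply (F' x))"
    by (simp add: blinfun.bounded_linear_right bounded_linear.linear)
  then have "blinfun_apply (F' x) = (\<lambda>h. h \<bullet> adjoint (blinfun_apply (F' x)) 1)"
    by (simp add: adjoint_works fun_eq_iff)
  then have "GDERIV F x :> adjoint (blinfun_apply (F' x)) 1"
    using F' unfolding gderiv_def by metis
  then show ?thesis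
    using gradient_eqI by metis
qed

lemma GDERIV_full_objective:
  assumes "\<And>j. j \<in> {1..N} \<Longrightarrow> GDERIV (f j) x :> D j"
  shows "GDERIV (full_objective N f) x :> (1 / real N) *\<^sub>R (\<Sum>j=1..N. D j)"
proof -
  have "((\<lambda>y. (1 / real N) * (\<Sum>j=1..N. f j y)) has_derivative
          (\<lambda>h. (1 / real N) * (\<Sum>j=1..N. h \<bullet> D j))) (at x)"
    using assms unfolding gderiv_def
    by (intro has_derivative_mult_right has_derivative_sum) auto
  then show ?thesis
    unfolding gderiv_def full_objective_def by (simp add: inner_sum_right)
qed

lemma lipschitz_on_mean:
  fixes D :: "nat \<Rightarrow> 'a::metric_space \<Rightarrow> 'b::real_normed_vector"
  assumes "N > 0" and "\<And>j. j \<in> {1..N} \<Longrightarrow> L-lipschitz_on U (D j)"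
  shows "L-lipschitz_on U (\<lambda>x. (1 / real N) *\<^sub>R (\<Sum>j=1..N. D j x))"
proof (rule lipschitz_onI)
  show "0 \<le> L"
    using assms lipschitz_on_nonneg[of L U "D 1"] by auto
  fix x y assume U: "x \<in> U" "y \<in> U"
  have "norm ((1 / real N) *\<^sub>R (\<Sum>j=1..N. D j x) - (1 / real N) *\<^sub>R (\<Sum>j=1..N. D j y))
      = (1 / real N) * norm (\<Sum>j=1..N. D j x - D j y)"
    by (simp add: sum_subtractf flip: scaleR_diff_right)
  also have "\<dots> \<le> (1 / real N) * (\<Sum>j=1..N. L * dist x y)"
    using assms(2) U
    by (intro mult_left_mono sum_norm_le) (auto simp: lipschitz_on_def dist_norm)
  also have "\<dots> = L * dist x y"
    using \<open>N > 0\<close> by simp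
  finally show "dist ((1 / real N) *\<^sub>R (\<Sum>j=1..N. D j x)) ((1 / real N) *\<^sub>R (\<Sum>j=1..N. D j y))
      \<le> L * dist x y"
    by (simp add: dist_norm)
qed

text \<open>The mean value theorem on the segment from \<open>x\<close> to \<open>x + v\<close> gives the constant \<open>L\<close> instead of
  the sharp \<open>L / 2\<close> that integrating the derivative would give. Every use below absorbs constants.\<close>

lemma descent_inequality:
  fixes F :: "'a::real_inner \<Rightarrow> real"
  assumes deriv: "\<And>x. GDERIV F x :> D x" and lip: "L-lipschitz_on UNIV D"
  shows "F (x + v) \<le> F x + D x \<bullet> v + L * (norm v)\<^sup>2"
proof -
  have "((\<lambda>s. F (x + s *\<^sub>R v)) has_derivative (\<lambda>h. (h *\<^sub>R v) \<bullet> D (x + s *\<^sub>R v)))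
      (at s within {0..1})" for s
  proof -
    have "((\<lambda>s. x + s *\<^sub>R v) has_derivative (\<lambda>h. h *\<^sub>R v)) (at s within {0..1})"
      by (auto intro!: derivative_eq_intros)
    from has_derivative_compose[OF this deriv[unfolded gderiv_def]]
    show ?thesis .
  qed
  then obtain s where s: "s \<in> {0..1}"
    and mvt: "F (x + 1 *\<^sub>R v) - F (x + 0 *\<^sub>R v) = ((1 - 0) *\<^sub>R v) \<bullet> D (x + s *\<^sub>R v)"
    using mvt_very_simple[of 0 1 "\<lambda>s. F (x + s *\<^sub>R v)" "\<lambda>s h. (h *\<^sub>R v) \<bullet> D (x + s *\<^sub>R v)"]
    by force
  have L: "L \<ge> 0"
    using lip by (rule lipschitz_on_nonneg)
  have "v \<bullet> (D (x + s *\<^sub>R v) - D x) \<le> norm v * norm (D (x + s *\<^sub>R v) - D x)"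
    by (rule norm_cauchy_schwarz)
  also have "\<dots> \<le> norm v * (L * norm (s *\<^sub>R v))"
    using lipschitz_onD[OF lip, of "x + s *\<^sub>R v" x]
    by (intro mult_left_mono) (auto simp: dist_norm)
  also have "\<dots> \<le> norm v * (L * norm v)"
    using s L by (intro mult_left_mono) (auto simp: mult_left_le_one_le)
  finally have "v \<bullet> (D (x + s *\<^sub>R v) - D x) \<le> L * (norm v)\<^sup>2"
    by (simp add: power2_eq_square mult_ac)
  then show ?thesis
    using mvt by (simp add: inner_diff_right inner_commute)
qed

text \<open>A step of length \<open>1 / (2 * L)\<close> along the negative gradient decreases \<open>F\<close> by at least
  \<open>(norm (D x))\<^sup>2 / (4 * L)\<close>, and \<open>F\<close> cannot fall below \<open>c\<close>. This is what lets gradient norms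
  be measured by the objective gap, so that all error terms below are multiples of the
  single quantity \<open>1 + (F x - c)\<close>.\<close>

lemma gradient_norm_le_gap:
  fixes F :: "'a::real_inner \<Rightarrow> real"
  assumes deriv: "\<And>x. GDERIV F x :> D x" and lip: "L-lipschitz_on UNIV D" and "L > 0"
    and lower: "\<And>x. c \<le> F x"
  shows "(norm (D x))\<^sup>2 \<le> 4 * L * (F x - c)"
proof -
  define v where "v = - (1 / (2 * L)) *\<^sub>R D x"
  have "c \<le> F x + D x \<bullet> v + L * (norm v)\<^sup>2"
    using lower[of "x + v"] descent_inequality[OF deriv lip, of x v] by linarith
  also have "\<dots> = F x - (norm (D x))\<^sup>2 / (4 * L)"
    using \<open>L > 0\<close>
    by (simp add: v_def power_divide power2_norm_eq_inner[symmetric] field_simps)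
      (simp add: power2_eq_square)
  finally show ?thesis
    using \<open>L > 0\<close> by (simp add: field_simps)
qed

text \<open>The growth condition \<open>norm g \<le> C * (1 + norm (D x))\<close> is what a sampled gradient satisfies. The
  first order term \<open>D x \<bullet> g\<close> is kept as it is in the second bound, because at a sampling iteration
  its expectation carries the decrease; the first bound is for those iterations whose step length
  is summable, where the size of this term suffices.\<close>

lemma inexact_gradient_step:
  fixes F :: "'a::real_inner \<Rightarrow> real"
  assumes deriv: "\<And>x. GDERIV F x :> D x" and lip: "L-lipschitz_on UNIV D" and "L > 0"
    and lower: "\<And>x. c \<le> F x" and "C \<ge> 0" and g: "norm g \<le> C * (1 + norm (D x))"
  shows "\<bar>D x \<bullet> g\<bar> \<le> 2 * C * (1 + 4 * L) * (1 + (F x - c))"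
    and "F (x - a *\<^sub>R g)
          \<le> F x - a * (D x \<bullet> g) + 2 * L * C\<^sup>2 * (1 + 4 * L) * a\<^sup>2 * (1 + (F x - c))"
proof -
  let ?G = "norm (D x)"
  have "4 * L * (F x - c) \<ge> 0" "F x - c \<ge> 0"
    using lower[of x] \<open>L > 0\<close> by auto
  then have gap: "1 + ?G\<^sup>2 \<le> (1 + 4 * L) * (1 + (F x - c))"
    using gradient_norm_le_gap[OF deriv lip \<open>L > 0\<close> lower, of x] \<open>L > 0\<close>
    by (simp add: algebra_simps)
  have "0 \<le> (1 - ?G)\<^sup>2"
    by simp
  then have sq: "(1 + ?G)\<^sup>2 \<le> 2 * (1 + ?G\<^sup>2)"
    by (simp add: power2_eq_square algebra_simps)
  have "\<bar>D x \<bullet> g\<bar> \<le> ?G * norm g"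
    by (rule Cauchy_Schwarz_ineq2)
  also have "\<dots> \<le> (1 + ?G) * (C * (1 + ?G))"
    using g by (intro mult_mono) auto
  also have "\<dots> = C * (1 + ?G)\<^sup>2"
    by (simp add: power2_eq_square)
  also have "\<dots> \<le> C * (2 * ((1 + 4 * L) * (1 + (F x - c))))"
    using sq gap \<open>C \<ge> 0\<close> by (intro mult_left_mono) auto
  finally show "\<bar>D x \<bullet> g\<bar> \<le> 2 * C * (1 + 4 * L) * (1 + (F x - c))"
    by (simp add: algebra_simps)
  have "(norm g)\<^sup>2 \<le> (C * (1 + ?G))\<^sup>2"
    using g by (intro power_mono) auto
  also have "\<dots> \<le> C\<^sup>2 * (2 * ((1 + 4 * L) * (1 + (F x - c))))"
    unfolding power_mult_distrib using sq gap by (intro mult_left_mono) auto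
  finally have "L * a\<^sup>2 * (norm g)\<^sup>2 \<le> L * a\<^sup>2 * (C\<^sup>2 * (2 * ((1 + 4 * L) * (1 + (F x - c)))))"
    using \<open>L > 0\<close> by (intro mult_left_mono) auto
  then show "F (x - a *\<^sub>R g)
      \<le> F x - a * (D x \<bullet> g) + 2 * L * C\<^sup>2 * (1 + 4 * L) * a\<^sup>2 * (1 + (F x - c))"
    using descent_inequality[OF deriv lip, of x "- (a *\<^sub>R g)"]
    by (simp add: power_mult_distrib mult_ac)
qed

section \<open>Runs of the algorithm\<close>

text \<open>An interpolated trial step is accepted only if it lies in \<open>[0.1 * \<alpha>, 0.9 * \<alpha>]\<close>, and it is replaced
  by \<open>\<alpha> / 2\<close> otherwise. So the trial steps shrink from 1 and stay positive.\<close>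

lemma ls_trial_bounds: "0 < ls_trial F x d dm j \<and> ls_trial F x d dm j \<le> 1"
proof (induction j)
  case 0
  show ?case by (simp add: ls_trial_def)
next
  case (Suc j)
  then show ?case
    by (auto simp: ls_trial_def ls_next_def Let_def)
qed

lemma ls_returns_unique:
  assumes "ls_returns F x d dm \<eta> \<tau> \<alpha>" and "ls_returns F x d dm \<eta> \<tau> \<alpha>'"
  shows "\<alpha> = \<alpha>'"
  using assms unfolding ls_returns_def by (metis linorder_neqE_nat)

lemma sub_objective_cong:
  "(\<And>l. l \<in> {1..S} \<Longrightarrow> i l = i' l) \<Longrightarrow> sub_objective f S i = sub_objective f S i'"
  by (simp add: sub_objective_def fun_eq_iff)

lemma sub_gradient_cong:
  "(\<And>l. l \<in> {1..S} \<Longrightarrow> i l = i' l) \<Longrightarrow> sub_gradient f S i = sub_gradient f S i'"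
  by (simp add: sub_gradient_def fun_eq_iff)

text \<open>The line search is deterministic, so the subsamples drawn before iteration \<open>K\<close> determine the
  iterate \<open>x K\<close>. The subsamples range over a finite set, so this makes \<open>x K\<close> a random variable
  with finitely many values, measurable with respect to the past; measurability and integrability
  of everything built from it follow.\<close>

lemma slises_run_determined:
  assumes run: "slises_run f S m x0 \<eta> \<gamma>min \<gamma>max \<delta> \<gamma>0 t i x"
    and run': "slises_run f S m x0 \<eta> \<gamma>min \<gamma>max \<delta> \<gamma>0 t i' x'"
    and same: "\<And>k l. k < K \<Longrightarrow> l \<in> {1..S} \<Longrightarrow> i k l = i' k l"
  shows "x K = x' K"
proof -
  obtain g \<gamma> d \<alpha> where r: "x 0 = x0" "\<And>k. g k = sub_gradient f S (i k) (x k)"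
    "\<And>k. \<gamma> k = (if m dvd k then \<gamma>0 / real (max k 1)
               else min \<gamma>max (max \<gamma>min (spectral_coeff (x k - x (k - 1)) (g k - g (k - 1))))
                      / real k powr (1 + \<delta>))"
    "\<And>k. d k = - (\<gamma> k *\<^sub>R g k)"
    "\<And>k. if m dvd k then \<alpha> k = 1
         else ls_returns (sub_objective f S (i k)) (x k) (d k) (g k \<bullet> d k) \<eta> (t k) (\<alpha> k)"
    "\<And>k. x (Suc k) = x k + \<alpha> k *\<^sub>R d k"
    using run unfolding slises_run_def by metis
  obtain g' \<gamma>' d' \<alpha>' where r': "x' 0 = x0" "\<And>k. g' k = sub_gradient f S (i' k) (x' k)"
    "\<And>k. \<gamma>' k = (if m dvd k then \<gamma>0 / real (max k 1)
               else min \<gamma>max (max \<gamma>min (spectral_coeff (x' k - x' (k - 1)) (g' k - g' (k - 1))))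
                      / real k powr (1 + \<delta>))"
    "\<And>k. d' k = - (\<gamma>' k *\<^sub>R g' k)"
    "\<And>k. if m dvd k then \<alpha>' k = 1
         else ls_returns (sub_objective f S (i' k)) (x' k) (d' k) (g' k \<bullet> d' k) \<eta> (t k) (\<alpha>' k)"
    "\<And>k. x' (Suc k) = x' k + \<alpha>' k *\<^sub>R d' k"
    using run' unfolding slises_run_def by metis
  have "x k = x' k" if "k \<le> K" for k
    using that
  proof (induction k rule: less_induct)
    case (less k)
    show ?case
    proof (cases k)
      case 0
      then show ?thesis using r(1) r'(1) by simp
    next
      case (Suc j)
      have X: "x j' = x' j'" if "j' \<le> j" for j'
        using less Suc that by auto
      have G: "g j' = g' j'" if "j' \<le> j" for j'
      proof -
        have "sub_gradient f S (i j') = sub_gradient f S (i' j')"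
          using same less.prems Suc that by (intro sub_gradient_cong) auto
        then show ?thesis
          using X[OF that] r(2) r'(2) by simp
      qed
      have \<gamma>: "\<gamma> j = \<gamma>' j"
        unfolding r(3) r'(3) using X G by simp
      have d: "d j = d' j"
        using r(4) r'(4) \<gamma> G by simp
      have "sub_objective f S (i j) = sub_objective f S (i' j)"
        using same less.prems Suc by (intro sub_objective_cong) auto
      then have "\<alpha> j = \<alpha>' j"
        using r(5)[of j] r'(5)[of j] X[of j] G[of j] d ls_returns_unique
        by (cases "m dvd j") auto
      then show ?thesis
        using Suc r(6) r'(6) d X by simp
    qed
  qed
  then show ?thesis by simp
qed

text \<open>The two kinds of iteration, reduced to what the convergence proof needs: step length
  \<open>\<gamma>0 / k\<close>, not summable, with a fresh sample; step length at most of order \<open>1 / k powr (1 + \<delta>)\<close>,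
  summable, with an old sample, on which the iterate already depends.\<close>

lemma slises_run_step:
  assumes run: "slises_run f S m x0 \<eta> \<gamma>min \<gamma>max \<delta> \<gamma>0 t i x"
    and "0 < \<gamma>min" and "\<gamma>min \<le> \<gamma>max"
  obtains (sampling) "m dvd k"
      "x (Suc k) = x k - (\<gamma>0 / real (max k 1)) *\<^sub>R sub_gradient f S (i k) (x k)"
    | (line_search) a where "\<not> m dvd k" "0 \<le> a" "a \<le> \<gamma>max / real k powr (1 + \<delta>)"
      "x (Suc k) = x k - a *\<^sub>R sub_gradient f S (i k) (x k)"
proof (cases "m dvd k")
  case True
  then show ?thesis
    using run that(1) unfolding slises_run_def by fastforce
next
  case False
  obtain g \<gamma> d \<alpha> where g: "g k = sub_gradient f S (i k) (x k)"
    and \<gamma>: "\<gamma> k = min \<gamma>max (max \<gamma>min (spectral_coeff (x k - x (k - 1)) (g k - g (k - 1))))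
                      / real k powr (1 + \<delta>)"
    and d: "d k = - (\<gamma> k *\<^sub>R g k)"
    and ls: "ls_returns (sub_objective f S (i k)) (x k) (d k) (g k \<bullet> d k) \<eta> (t k) (\<alpha> k)"
    and step: "x (Suc k) = x k + \<alpha> k *\<^sub>R d k"
    using run False unfolding slises_run_def by metis
  have \<alpha>: "0 \<le> \<alpha> k" "\<alpha> k \<le> 1"
    using ls ls_trial_bounds unfolding ls_returns_def by (metis less_imp_le)+
  have "0 \<le> \<gamma> k" "\<gamma> k \<le> \<gamma>max / real k powr (1 + \<delta>)"
    unfolding \<gamma> using assms(2,3) by (auto intro!: divide_nonneg_nonneg divide_right_mono)
  then have "0 \<le> \<alpha> k * \<gamma> k" "\<alpha> k * \<gamma> k \<le> \<gamma>max / real k powr (1 + \<delta>)"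
    using \<alpha> mult_left_le_one_le[of "\<gamma> k" "\<alpha> k"] by auto
  moreover have "x (Suc k) = x k - (\<alpha> k * \<gamma> k) *\<^sub>R sub_gradient f S (i k) (x k)"
    unfolding step d g by simp
  ultimately show ?thesis
    using that(2) False by blast
qed

section \<open>Random variables that depend on the past\<close>

lemma subalgebra_history:
  assumes "\<And>k' l. k' < k \<Longrightarrow> l \<in> {1..S} \<Longrightarrow> i k' l \<in> measurable M (count_space {1..N})"
  shows "subalgebra M (history M N S i k)"
proof -
  have "(\<Union>k'<k. \<Union>l\<in>{1..S}. {i k' l -` A \<inter> space M | A. A \<subseteq> {1..N}}) \<subseteq> sets M"
    using assms by (auto intro: measurable_sets[where A = "count_space {1..N}"])
  then show ?thesis
    unfolding subalgebra_def history_def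
    by (auto simp: space_measure_of_conv sets_measure_of_conv sets.sigma_sets_subset
             dest: subsetD[OF sets.sigma_sets_subset] split: if_splits)
qed

text \<open>\<open>X\<close> factors through the tuple \<open>\<phi>\<close> of all indices drawn so far. This tuple has finitely many
  values, and each of its level sets is a finite intersection of generators of the history, so
  every preimage under \<open>X\<close> is a finite union of such atoms.\<close>

lemma measurable_history_if_determined:
  assumes idx: "\<And>k' l. k' < k \<Longrightarrow> l \<in> {1..S} \<Longrightarrow> i k' l \<in> measurable M (count_space {1..N})"
    and det: "\<And>\<omega> \<omega>'. \<omega> \<in> space M \<Longrightarrow> \<omega>' \<in> space M \<Longrightarrow>
        (\<And>k' l. k' < k \<Longrightarrow> l \<in> {1..S} \<Longrightarrow> i k' l \<omega> = i k' l \<omega>') \<Longrightarrow> X \<omega> = X \<omega>'"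
  shows "X \<in> measurable (history M N S i k) (count_space UNIV)" and "finite (X ` space M)"
proof -
  let ?H = "history M N S i k"
  define I where "I = {..<k} \<times> {1..S}"
  define \<phi> where "\<phi> \<omega> = restrict (\<lambda>(k', l). i k' l \<omega>) I" for \<omega>
  have space_H [simp]: "space ?H = space M"
    by (simp add: history_def space_measure_of_conv)
  have generator: "i k' l -` A \<inter> space M \<in> sets ?H"
    if "k' < k" "l \<in> {1..S}" "A \<subseteq> {1..N}" for k' l A
  proof -
    have "i k' l -` A \<inter> space M \<in> (\<Union>k'<k. \<Union>l\<in>{1..S}. {i k' l -` A \<inter> space M | A. A \<subseteq> {1..N}})"
      using that by blast
    then show ?thesis
      unfolding history_def by (subst sets_measure_of) auto
  qed
  have "\<phi> ` space M \<subseteq> I \<rightarrow>\<^sub>E {1..N}"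
    using measurable_space[OF idx] by (fastforce simp: \<phi>_def I_def)
  moreover have "finite (I \<rightarrow>\<^sub>E {1..N})"
    by (intro finite_PiE) (auto simp: I_def)
  ultimately have fin: "finite (\<phi> ` space M)"
    by (rule finite_subset)
  have factor: "X \<omega> = X \<omega>'" if "\<omega> \<in> space M" "\<omega>' \<in> space M" "\<phi> \<omega> = \<phi> \<omega>'" for \<omega> \<omega>'
  proof (rule det[OF that(1,2)])
    fix k' l assume "k' < k" "l \<in> {1..S}"
    then have "(k', l) \<in> I" by (simp add: I_def)
    with fun_cong[OF that(3), of "(k', l)"] show "i k' l \<omega> = i k' l \<omega>'"
      by (simp add: \<phi>_def)
  qed
  have "\<exists>h. \<forall>\<omega>\<in>space M. X \<omega> = h (\<phi> \<omega>)"
    by (rule exI[of _ "\<lambda>z. X (SOME \<omega>. \<omega> \<in> space M \<and> \<phi> \<omega> = z)"])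
       (metis (mono_tags, lifting) factor someI_ex)
  then obtain h where h: "\<And>\<omega>. \<omega> \<in> space M \<Longrightarrow> X \<omega> = h (\<phi> \<omega>)"
    by blast
  then have "X ` space M = h ` \<phi> ` space M"
    by (force simp: image_image)
  with fin show "finite (X ` space M)"
    by simp
  have atom: "\<phi> -` {\<phi> \<omega>} \<inter> space M \<in> sets ?H" if "\<omega> \<in> space M" for \<omega>
  proof -
    have "{\<omega>' \<in> space ?H. i (fst z) (snd z) \<omega>' = i (fst z) (snd z) \<omega>} \<in> sets ?H" if "z \<in> I" for z
    proof -
      have "i (fst z) (snd z) \<omega> \<in> {1..N}"
        using measurable_space[OF idx[of "fst z" "snd z"] \<open>\<omega> \<in> space M\<close>] that by (auto simp: I_def)
      then have "i (fst z) (snd z) -` {i (fst z) (snd z) \<omega>} \<inter> space M \<in> sets ?H"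
        using that by (intro generator) (auto simp: I_def)
      then show ?thesis
        by (simp add: vimage_def Int_def conj_commute)
    qed
    then have "{\<omega>' \<in> space ?H. \<forall>z\<in>I. i (fst z) (snd z) \<omega>' = i (fst z) (snd z) \<omega>} \<in> sets ?H"
      by (intro sets.sets_Collect_finite_All) (auto simp: I_def)
    also have "{\<omega>' \<in> space ?H. \<forall>z\<in>I. i (fst z) (snd z) \<omega>' = i (fst z) (snd z) \<omega>}
        = \<phi> -` {\<phi> \<omega>} \<inter> space M"
      by (fastforce simp: \<phi>_def fun_eq_iff restrict_def split: if_splits)
    finally show ?thesis .
  qed
  show "X \<in> measurable ?H (count_space UNIV)"
  proof (rule measurableI)
    fix A
    have "X -` A \<inter> space ?H = (\<Union>z\<in>\<phi> ` (X -` A \<inter> space M). \<phi> -` {z} \<inter> space M)"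
      using factor by auto
    also have "\<dots> \<in> sets ?H"
      using atom by (intro sets.finite_UN finite_subset[OF _ fin]) auto
    finally show "X -` A \<inter> space ?H \<in> sets ?H" .
  qed simp
qed

lemma (in finite_measure) integrable_finite_range:
  fixes h :: "'b \<Rightarrow> real"
  assumes "X \<in> measurable M (count_space UNIV)" and "finite (X ` space M)"
  shows "integrable M (\<lambda>\<omega>. h (X \<omega>))"
proof (rule integrable_const_bound[where B = "Max ((\<lambda>y. \<bar>h y\<bar>) ` X ` space M)"])
  show "(\<lambda>\<omega>. h (X \<omega>)) \<in> borel_measurable M"
    using measurable_compose[OF assms(1), of h borel] by simp
  show "AE \<omega> in M. norm (h (X \<omega>)) \<le> Max ((\<lambda>y. \<bar>h y\<bar>) ` X ` space M)"
    using assms(2) by (intro AE_I2) auto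
qed

section \<open>Near-unbiasedness of the sampled gradient\<close>

text \<open>Write \<open>Z (I \<omega>) \<omega>\<close> as the sum over \<open>j\<close> of \<open>Z j\<close> times the indicator of the event that \<open>j\<close> is
  drawn. As \<open>Z j\<close> is known at the time of the draw, the indicator may be replaced under the
  expectation by its conditional probability, which differs from \<open>q\<close> by at most \<open>e\<close>.\<close>

lemma (in prob_space) expectation_at_sampled_index:
  fixes Z :: "nat \<Rightarrow> 'a \<Rightarrow> real"
  assumes sub: "subalgebra M H"
    and I: "I \<in> measurable M (count_space {1..N})"
    and close: "\<And>j. j \<in> {1..N} \<Longrightarrow>
        AE \<omega> in M. \<bar>conditional_probability M H (I -` {j} \<inter> space M) \<omega> - q\<bar> \<le> e"
    and Z: "\<And>j. j \<in> {1..N} \<Longrightarrow> Z j \<in> borel_measurable H" "\<And>j. j \<in> {1..N} \<Longrightarrow> integrable M (Z j)"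
  shows "integrable M (\<lambda>\<omega>. Z (I \<omega>) \<omega>)"
    and "(\<Sum>j=1..N. q * expectation (Z j) - e * expectation (\<lambda>\<omega>. \<bar>Z j \<omega>\<bar>))
          \<le> expectation (\<lambda>\<omega>. Z (I \<omega>) \<omega>)"
proof -
  interpret H: finite_measure_subalgebra M H
    by unfold_locales (rule sub)
  let ?A = "\<lambda>j. I -` {j} \<inter> space M"
  have A: "?A j \<in> sets M" if "j \<in> {1..N}" for j
    using I that by (intro measurable_sets[OF I]) auto
  have split: "Z (I \<omega>) \<omega> = (\<Sum>j=1..N. Z j \<omega> * indicator (?A j) \<omega>)" if "\<omega> \<in> space M" for \<omega>
  proof -
    have "I \<omega> \<in> {1..N}"
      using measurable_space[OF I that] by simp
    moreover have "(\<Sum>j=1..N. Z j \<omega> * indicator (?A j) \<omega>)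
        = (\<Sum>j=1..N. if j = I \<omega> then Z j \<omega> else 0)"
      using that by (intro sum.cong) (auto simp: indicator_def)
    ultimately show ?thesis by simp
  qed
  have int: "integrable M (\<lambda>\<omega>. Z j \<omega> * indicator (?A j) \<omega>)" if "j \<in> {1..N}" for j
    using A[OF that] Z(2)[OF that] by (rule integrable_real_mult_indicator)
  have "integrable M (\<lambda>\<omega>. \<Sum>j=1..N. Z j \<omega> * indicator (?A j) \<omega>)"
    by (rule Bochner_Integration.integrable_sum) (rule int)
  then show "integrable M (\<lambda>\<omega>. Z (I \<omega>) \<omega>)"
    by (subst Bochner_Integration.integrable_cong[OF refl split]) auto
  have lower: "q * expectation (Z j) - e * expectation (\<lambda>\<omega>. \<bar>Z j \<omega>\<bar>)
      \<le> expectation (\<lambda>\<omega>. Z j \<omega> * indicator (?A j) \<omega>)" if j: "j \<in> {1..N}" for j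
  proof -
    have meas: "(indicator (?A j) :: _ \<Rightarrow> real) \<in> borel_measurable M"
      using A[OF j] by simp
    note cond = H.real_cond_exp_intg[OF int[OF j] Z(1)[OF j] meas]
    have "q * expectation (Z j) - e * expectation (\<lambda>\<omega>. \<bar>Z j \<omega>\<bar>)
        = expectation (\<lambda>\<omega>. q * Z j \<omega> - e * \<bar>Z j \<omega>\<bar>)"
      using Z(2)[OF j] by simp
    also have "\<dots> \<le> expectation (\<lambda>\<omega>. Z j \<omega> * real_cond_exp M H (indicator (?A j)) \<omega>)"
    proof (rule integral_mono_AE)
      show "integrable M (\<lambda>\<omega>. q * Z j \<omega> - e * \<bar>Z j \<omega>\<bar>)"
        using Z(2)[OF j] by simp
      show "AE \<omega> in M. q * Z j \<omega> - e * \<bar>Z j \<omega>\<bar>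
          \<le> Z j \<omega> * real_cond_exp M H (indicator (?A j)) \<omega>"
        using close[OF j] unfolding conditional_probability_def
      proof eventually_elim
        case (elim \<omega>)
        let ?P = "real_cond_exp M H (indicator (?A j)) \<omega>"
        have "\<bar>Z j \<omega> * (?P - q)\<bar> \<le> \<bar>Z j \<omega>\<bar> * e"
          unfolding abs_mult using elim by (intro mult_left_mono) auto
        then show ?case
          by (simp add: algebra_simps abs_le_iff)
      qed
    qed (rule cond(1))
    finally show ?thesis
      using cond(2) by simp
  qed
  have "expectation (\<lambda>\<omega>. Z (I \<omega>) \<omega>)
      = expectation (\<lambda>\<omega>. \<Sum>j=1..N. Z j \<omega> * indicator (?A j) \<omega>)"
    by (rule Bochner_Integration.integral_cong[OF refl split])
  also have "\<dots> = (\<Sum>j=1..N. expectation (\<lambda>\<omega>. Z j \<omega> * indicator (?A j) \<omega>))"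
    by (rule Bochner_Integration.integral_sum) (rule int)
  finally show "(\<Sum>j=1..N. q * expectation (Z j) - e * expectation (\<lambda>\<omega>. \<bar>Z j \<omega>\<bar>))
      \<le> expectation (\<lambda>\<omega>. Z (I \<omega>) \<omega>)"
    using sum_mono[OF lower, of "{1..N}" id] by simp
qed

text \<open>With exactly uniform probabilities, each sampled gradient would have conditional expectation
  \<open>D (X \<omega>)\<close>, which gives the term \<open>(norm (D (X \<omega>)))\<^sup>2\<close>. The deviation \<open>e\<close> enters once for each of the
  \<open>N\<close> functions. By linearity of the expectation, one index can be treated at a time.\<close>

lemma (in prob_space) sub_gradient_nearly_unbiased:
  fixes f :: "nat \<Rightarrow> 'b::real_inner \<Rightarrow> real" and B :: "'b \<Rightarrow> real" and N :: nat
  defines "D \<equiv> \<lambda>y. (1 / real N) *\<^sub>R (\<Sum>j=1..N. gradient (f j) y)"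
  assumes sub: "subalgebra M H" and "S > 0" and "e \<ge> 0"
    and X: "X \<in> measurable H (count_space UNIV)" "finite (X ` space M)"
    and I: "\<And>l. l \<in> {1..S} \<Longrightarrow> I l \<in> measurable M (count_space {1..N})"
    and close: "\<And>l j. l \<in> {1..S} \<Longrightarrow> j \<in> {1..N} \<Longrightarrow>
        AE \<omega> in M. \<bar>conditional_probability M H (I l -` {j} \<inter> space M) \<omega> - 1 / real N\<bar> \<le> e"
    and B: "\<And>j y. j \<in> {1..N} \<Longrightarrow> \<bar>D y \<bullet> gradient (f j) y\<bar> \<le> B y"
  shows "integrable M (\<lambda>\<omega>. D (X \<omega>) \<bullet> sub_gradient f S (\<lambda>l. I l \<omega>) (X \<omega>))"
    and "expectation (\<lambda>\<omega>. (norm (D (X \<omega>)))\<^sup>2) - e * real N * expectation (\<lambda>\<omega>. B (X \<omega>))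
          \<le> expectation (\<lambda>\<omega>. D (X \<omega>) \<bullet> sub_gradient f S (\<lambda>l. I l \<omega>) (X \<omega>))"
proof -
  have X': "X \<in> measurable M (count_space UNIV)"
    using sub X(1) by (rule measurable_from_subalg)
  note int = integrable_finite_range[OF X' X(2)]
  define z where "z j y = D y \<bullet> gradient (f j) y" for j y
  have eq: "D (X \<omega>) \<bullet> sub_gradient f S (\<lambda>l. I l \<omega>) (X \<omega>)
      = (1 / real S) * (\<Sum>l=1..S. z (I l \<omega>) (X \<omega>))" for \<omega>
    by (simp add: sub_gradient_def z_def inner_sum_right)
  have zH: "(\<lambda>\<omega>. z j (X \<omega>)) \<in> borel_measurable H" for j
    using measurable_compose[OF X(1), of "z j" borel] by simp
  have sample_int: "integrable M (\<lambda>\<omega>. z (I l \<omega>) (X \<omega>))"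
    and sample_low: "(\<Sum>j=1..N. 1 / real N * expectation (\<lambda>\<omega>. z j (X \<omega>))
        - e * expectation (\<lambda>\<omega>. \<bar>z j (X \<omega>)\<bar>)) \<le> expectation (\<lambda>\<omega>. z (I l \<omega>) (X \<omega>))"
    if l: "l \<in> {1..S}" for l
    using expectation_at_sampled_index[where Z = "\<lambda>j \<omega>. z j (X \<omega>)",
        OF sub I[OF l] close[OF l] zH int]
    by simp_all
  then show "integrable M (\<lambda>\<omega>. D (X \<omega>) \<bullet> sub_gradient f S (\<lambda>l. I l \<omega>) (X \<omega>))"
    unfolding eq by (intro integrable_mult_right Bochner_Integration.integrable_sum sample_int)
  let ?low = "expectation (\<lambda>\<omega>. (norm (D (X \<omega>)))\<^sup>2) - e * real N * expectation (\<lambda>\<omega>. B (X \<omega>))"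
  have each: "?low \<le> expectation (\<lambda>\<omega>. z (I l \<omega>) (X \<omega>))" if l: "l \<in> {1..S}" for l
  proof -
    have "(norm (D y))\<^sup>2 = (\<Sum>j=1..N. 1 / real N * z j y)" for y
    proof -
      have "D y \<bullet> D y = D y \<bullet> ((1 / real N) *\<^sub>R (\<Sum>j=1..N. gradient (f j) y))"
        by (simp add: D_def)
      then show ?thesis
        by (simp add: power2_norm_eq_inner z_def inner_sum_right sum_distrib_left)
    qed
    then have "expectation (\<lambda>\<omega>. (norm (D (X \<omega>)))\<^sup>2)
        = (\<Sum>j=1..N. 1 / real N * expectation (\<lambda>\<omega>. z j (X \<omega>)))"
      by (simp add: Bochner_Integration.integral_sum[OF int] int
            del: integral_divide_zero flip: sum_divide_distrib)
    moreover have "(\<Sum>j=1..N. e * expectation (\<lambda>\<omega>. \<bar>z j (X \<omega>)\<bar>))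
        \<le> (\<Sum>j=1..N. e * expectation (\<lambda>\<omega>. B (X \<omega>)))"
      using B \<open>e \<ge> 0\<close>
      by (intro sum_mono mult_left_mono integral_mono int[where h = B]
            int[where h = "\<lambda>y. \<bar>z _ y\<bar>"]) (auto simp: z_def)
    ultimately have "?low \<le> (\<Sum>j=1..N. 1 / real N * expectation (\<lambda>\<omega>. z j (X \<omega>))
        - e * expectation (\<lambda>\<omega>. \<bar>z j (X \<omega>)\<bar>))"
      by (simp add: sum_subtractf mult_ac)
    also have "\<dots> \<le> expectation (\<lambda>\<omega>. z (I l \<omega>) (X \<omega>))"
      using l by (rule sample_low)
    finally show ?thesis .
  qed
  have "?low = (1 / real S) * (\<Sum>l=1..S. ?low)"
    using \<open>S > 0\<close> by simp
  also have "\<dots> \<le> (1 / real S) * (\<Sum>l=1..S. expectation (\<lambda>\<omega>. z (I l \<omega>) (X \<omega>)))"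
    using each by (intro mult_left_mono sum_mono) auto
  also have "\<dots> = expectation (\<lambda>\<omega>. D (X \<omega>) \<bullet> sub_gradient f S (\<lambda>l. I l \<omega>) (X \<omega>))"
    unfolding eq by (subst integral_mult_right_zero) (simp add: sample_int)
  finally show "?low \<le> expectation (\<lambda>\<omega>. D (X \<omega>) \<bullet> sub_gradient f S (\<lambda>l. I l \<omega>) (X \<omega>))" .
qed

section \<open>Summability of the expected decrease\<close>

text \<open>A deterministic counterpart of the Robbins-Siegmund lemma. Dividing the recursion for \<open>1 + u k\<close>
  by the products of the factors \<open>1 + b j\<close> would turn it into a telescoping sum; equivalently, these
  products, which are bounded by \<open>exp (\<Sum>j. b j)\<close>, control \<open>1 + u k\<close> together with the partial sums of \<open>w\<close>.\<close>

lemma perturbed_descent_summable: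
  fixes u w b :: "nat \<Rightarrow> real"
  assumes u: "\<And>k. 0 \<le> u k" and w: "\<And>k. 0 \<le> w k" and b: "\<And>k. 0 \<le> b k"
    and "summable b"
    and rec: "\<And>k. u (Suc k) \<le> u k - w k + b k * (1 + u k)"
  shows "summable w"
proof -
  have prod_ge_1: "1 \<le> (\<Prod>j<k. 1 + b j)" for k
    using b by (intro prod_ge_1) (simp add: add_increasing2)
  have bound: "1 + u k + (\<Sum>j<k. w j) \<le> (\<Prod>j<k. 1 + b j) * (1 + u 0)" for k
  proof (induction k)
    case 0
    show ?case by simp
  next
    case (Suc k)
    have "1 + u (Suc k) + (\<Sum>j<Suc k. w j) \<le> (1 + b k) * (1 + u k) + (\<Sum>j<k. w j)"
      using rec[of k] by (simp add: algebra_simps)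
    also have "\<dots> \<le> (1 + b k) * (1 + u k + (\<Sum>j<k. w j))"
      using b[of k] sum_nonneg[of "{..<k}" w] w by (simp add: algebra_simps)
    also have "\<dots> \<le> (1 + b k) * ((\<Prod>j<k. 1 + b j) * (1 + u 0))"
      using Suc b[of k] by (intro mult_left_mono) auto
    finally show ?case by (simp add: mult_ac)
  qed
  have "(\<Sum>j<k. w j) \<le> exp (suminf b) * (1 + u 0)" for k
  proof -
    have "(\<Prod>j<k. 1 + b j) \<le> (\<Prod>j<k. exp (b j))"
      using b by (intro prod_mono) auto
    also have "\<dots> = exp (\<Sum>j<k. b j)"
      by (simp add: exp_sum)
    also have "\<dots> \<le> exp (suminf b)"
      using sum_le_suminf[OF \<open>summable b\<close>, of "{..<k}"] b by simp
    finally have "(\<Prod>j<k. 1 + b j) * (1 + u 0) \<le> exp (suminf b) * (1 + u 0)"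
      using u[of 0] by (intro mult_right_mono) auto
    with bound[of k] u[of k] show ?thesis by linarith
  qed
  with w show ?thesis by (rule summableI_nonneg_bounded)
qed

text \<open>If \<open>G\<close> stayed above some \<open>e > 0\<close>, then the terms at the multiples of \<open>m\<close> would dominate a
  multiple of the harmonic series.\<close>

lemma liminf_eq_0_of_weighted_squares_summable:
  fixes G :: "nat \<Rightarrow> real"
  assumes "m > 0" and "c > 0" and G: "\<And>k. 0 \<le> G k"
    and sum: "summable (\<lambda>k. if m dvd k then c / real k * (G k)\<^sup>2 else 0)"
  shows "liminf (\<lambda>k. ereal (G k)) = 0"
proof (rule antisym)
  show "0 \<le> liminf (\<lambda>k. ereal (G k))"
    using G by (intro Liminf_bounded) auto
  show "liminf (\<lambda>k. ereal (G k)) \<le> 0"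
  proof (rule ccontr)
    assume "\<not> liminf (\<lambda>k. ereal (G k)) \<le> 0"
    then obtain e where "0 < ereal e" "ereal e < liminf (\<lambda>k. ereal (G k))"
      using ereal_dense2[of 0 "liminf (\<lambda>k. ereal (G k))"] unfolding not_le by metis
    then have e: "e > 0" and "\<forall>\<^sub>F k in sequentially. e < G k"
      using less_LiminfD[of "ereal e" sequentially "\<lambda>k. ereal (G k)"] by auto
    then obtain K where K: "\<And>k. k \<ge> K \<Longrightarrow> e < G k"
      unfolding eventually_sequentially by blast
    have "summable ((\<lambda>k. if m dvd k then c / real k * (G k)\<^sup>2 else 0) \<circ> (*) m)"
      using sum \<open>m > 0\<close> \<open>c > 0\<close> by (intro summable_reindex) (auto simp: inj_on_def)
    then have "summable (\<lambda>q. c / real (m * q) * (G (m * q))\<^sup>2)"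
      by (simp add: o_def)
    then have "summable (\<lambda>q. c * e\<^sup>2 / real m * inverse (real q))"
    proof (rule summable_comparison_test'[where N = K])
      fix q assume "q \<ge> K"
      then have "e < G (m * q)"
        using \<open>m > 0\<close> by (intro K) (metis le_trans mult_le_mono1 nat_mult_1 Suc_leI One_nat_def)
      then have "c / real (m * q) * e\<^sup>2 \<le> c / real (m * q) * (G (m * q))\<^sup>2"
        using e \<open>c > 0\<close> by (intro mult_left_mono power_mono) auto
      then show "norm (c * e\<^sup>2 / real m * inverse (real q)) \<le> c / real (m * q) * (G (m * q))\<^sup>2"
        using e \<open>c > 0\<close> by (simp add: divide_inverse mult_ac)
    qed
    then have "summable (\<lambda>q. inverse (real q))"
      by (rule summable_mult_D) (use e \<open>c > 0\<close> \<open>m > 0\<close> in simp)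
    then show False
      using not_summable_harmonic[where 'a = real] by simp
  qed
qed

lemma (in prob_space) AE_summable_if_expectations_summable:
  fixes W :: "nat \<Rightarrow> 'a \<Rightarrow> real"
  assumes W: "\<And>k. integrable M (W k)" "\<And>k \<omega>. 0 \<le> W k \<omega>"
    and sum: "summable (\<lambda>k. expectation (W k))"
  shows "AE \<omega> in M. summable (\<lambda>k. W k \<omega>)"
proof -
  have [measurable]: "W k \<in> borel_measurable M" for k
    using W(1) by auto
  have "(\<integral>\<^sup>+\<omega>. (\<Sum>k. ennreal (W k \<omega>)) \<partial>M) = (\<Sum>k. \<integral>\<^sup>+\<omega>. ennreal (W k \<omega>) \<partial>M)"
    by (rule nn_integral_suminf) measurable
  also have "\<dots> = (\<Sum>k. ennreal (expectation (W k)))"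
    using W by (simp add: nn_integral_eq_integral)
  also have "\<dots> = ennreal (\<Sum>k. expectation (W k))"
    using W sum by (intro suminf_ennreal2) auto
  finally have "(\<integral>\<^sup>+\<omega>. (\<Sum>k. ennreal (W k \<omega>)) \<partial>M) \<noteq> \<infinity>"
    by simp
  then have "AE \<omega> in M. (\<Sum>k. ennreal (W k \<omega>)) \<noteq> \<infinity>"
    by (intro nn_integral_noteq_infinite) measurable
  then show ?thesis
    by eventually_elim (use W(2) in \<open>auto intro!: summable_suminf_not_top\<close>)
qed

section \<open>Convergence of the modified SLiSeS algorithm\<close>

theorem theorem3p4:
  fixes M :: "'w measure"
    and f :: "nat \<Rightarrow> real ^ 'n \<Rightarrow> real"
    and N S m :: nat
    and x0 :: "real ^ 'n"
    and \<eta> \<gamma>min \<gamma>max \<delta> \<gamma>0 tbar L M1 M2 M3 \<epsilon> :: real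
    and t :: "nat \<Rightarrow> real"
    and i :: "nat \<Rightarrow> nat \<Rightarrow> 'w \<Rightarrow> nat"
    and p :: "nat \<Rightarrow> nat \<Rightarrow> 'w \<Rightarrow> real"
    and x :: "nat \<Rightarrow> 'w \<Rightarrow> real ^ 'n"
  assumes "prob_space M"
    and "S \<in> {1..N}" and "m > 0" and "0 < \<eta>" and "\<eta> < 1"
    and "0 < \<gamma>min" and "\<gamma>min \<le> 1" and "1 \<le> \<gamma>max" and "\<delta> > 0" and "\<gamma>0 > 0"
    and "\<And>k. t k \<ge> 0" and "summable t" and "suminf t \<le> tbar"
    and A1_bounded: "\<And>j. j \<in> {1..N} \<Longrightarrow> bdd_below (range (f j))"
    and A1_C2: "\<And>j. j \<in> {1..N} \<Longrightarrow> twice_continuously_differentiable (f j)"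
    and A1_lipschitz: "\<And>j. j \<in> {1..N} \<Longrightarrow> L-lipschitz_on UNIV (gradient (f j))"
    and A4_sampling: "nonuniform_sampling M N S m i p"
    and A4_constants: "M3 \<ge> 0" "\<epsilon> > 0"
    and A4_bound: "\<And>k j. k \<ge> 1 \<Longrightarrow> m dvd k \<Longrightarrow> j \<in> {1..N} \<Longrightarrow>
                     AE \<omega> in M. \<bar>p k j \<omega> - 1 / real N\<bar> \<le> M3 / real k powr \<epsilon>"
    and A5: "\<And>j y. j \<in> {1..N} \<Longrightarrow>
               norm (gradient (f j) y) \<le> M1 + M2 * norm (gradient (full_objective N f) y)"
    and run: "\<And>\<omega>. \<omega> \<in> space M \<Longrightarrow>
                slises_run f S m x0 \<eta> \<gamma>min \<gamma>max \<delta> \<gamma>0 t (\<lambda>k l. i k l \<omega>) (\<lambda>k. x k \<omega>)"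
  shows "AE \<omega> in M. liminf (\<lambda>k. ereal (norm (gradient (full_objective N f) (x k \<omega>)))) = 0"
proof -
  interpret prob_space M by fact
  have NS: "N > 0" "S > 0"
    using \<open>S \<in> {1..N}\<close> by auto

  define F where "F = full_objective N f"
  define D where "D y = (1 / real N) *\<^sub>R (\<Sum>j=1..N. gradient (f j) y)" for y
  \<comment> \<open>The constant \<open>L\<close> may be 0; the bound of the gradient by the gap needs a positive one.\<close>
  define \<Lambda> where "\<Lambda> = L + 1"
  define C where "C = \<bar>M1\<bar> + \<bar>M2\<bar>"
  have deriv: "GDERIV F y :> D y" for y
    unfolding F_def D_def using A1_C2 by (intro GDERIV_full_objective C2_imp_GDERIV_gradient)
  then have grad: "gradient (full_objective N f) = D"
    unfolding F_def by (simp add: gradient_eqI fun_eq_iff)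
  have "L \<ge> 0"
    using A1_lipschitz[of 1] NS by (auto intro: lipschitz_on_nonneg)
  then have \<Lambda>: "\<Lambda> > 0"
    by (simp add: \<Lambda>_def)
  have lip: "\<Lambda>-lipschitz_on UNIV D"
    unfolding D_def \<Lambda>_def
    using NS by (intro lipschitz_on_mean lipschitz_on_le[OF A1_lipschitz]) auto
  have C: "C \<ge> 0"
    by (simp add: C_def)
  have grad_bound: "norm (gradient (f j) y) \<le> C * (1 + norm (D y))" if "j \<in> {1..N}" for j y
  proof -
    have "norm (gradient (f j) y) \<le> M1 + M2 * norm (D y)"
      using A5[OF that, of y] by (simp add: grad)
    also have "\<dots> \<le> (\<bar>M1\<bar> + \<bar>M2\<bar>) + (\<bar>M1\<bar> + \<bar>M2\<bar>) * norm (D y)"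
      by (intro add_mono mult_right_mono) auto
    finally show ?thesis
      by (simp add: C_def distrib_left)
  qed
  obtain c where c: "\<And>y. c \<le> F y"
  proof -
    have "\<exists>c. \<forall>y. c \<le> f j y" if "j \<in> {1..N}" for j
      using A1_bounded[OF that] by (auto simp: bdd_below_def)
    then obtain cs where cs: "\<And>j y. j \<in> {1..N} \<Longrightarrow> cs j \<le> f j y"
      by metis
    have "(1 / real N) * (\<Sum>j=1..N. cs j) \<le> F y" for y
      unfolding F_def full_objective_def using cs by (intro mult_left_mono sum_mono) auto
    then show ?thesis
      using that by blast
  qed
  define V where "V y = F y - c" for y
  have V: "0 \<le> V y" for y
    using c by (simp add: V_def)

  have idx: "i k l \<in> measurable M (count_space {1..N})" if "l \<in> {1..S}" for k l
    using A4_sampling that unfolding nonuniform_sampling_def by blast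
  have sub: "subalgebra M (history M N S i k)" for k
    using idx by (rule subalgebra_history)
  have det: "x k \<omega> = x k \<omega>'"
    if "\<omega> \<in> space M" "\<omega>' \<in> space M"
      "\<And>k' l. k' < k \<Longrightarrow> l \<in> {1..S} \<Longrightarrow> i k' l \<omega> = i k' l \<omega>'" for k \<omega> \<omega>'
    using slises_run_determined[OF run[OF that(1)] run[OF that(2)] that(3)] .
  have x_history: "x k \<in> measurable (history M N S i k) (count_space UNIV)"
    and x_finite: "finite (x k ` space M)" for k
    by (rule measurable_history_if_determined[OF idx det]; assumption)+
  have int: "integrable M (\<lambda>\<omega>. h (x k \<omega>))" for h :: "real ^ 'n \<Rightarrow> real" and k
    by (rule integrable_finite_range[OF measurable_from_subalg[OF sub x_history] x_finite])

  define g where "g k \<omega> = sub_gradient f S (\<lambda>l. i k l \<omega>) (x k \<omega>)" for k \<omega>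
  have g_bound: "norm (g k \<omega>) \<le> C * (1 + norm (D (x k \<omega>)))" if "\<omega> \<in> space M" for k \<omega>
  proof -
    have "norm (g k \<omega>) = (1 / real S) * norm (\<Sum>l=1..S. gradient (f (i k l \<omega>)) (x k \<omega>))"
      by (simp add: g_def sub_gradient_def)
    also have "\<dots> \<le> (1 / real S) * (\<Sum>l=1..S. C * (1 + norm (D (x k \<omega>))))"
      using measurable_space[OF idx that]
      by (intro mult_left_mono sum_norm_le grad_bound) auto
    finally show ?thesis
      using NS by simp
  qed
  define E where "E = 1 + 4 * \<Lambda>"
  have E: "E \<ge> 0"
    using \<Lambda> by (simp add: E_def)
  note inner_bound = inexact_gradient_step(1)[OF deriv lip \<Lambda> c C, folded V_def E_def]
  have step_bound: "V (y - a *\<^sub>R v)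
      \<le> V y - a * (D y \<bullet> v) + 2 * \<Lambda> * C\<^sup>2 * E * a\<^sup>2 * (1 + V y)"
    if "norm v \<le> C * (1 + norm (D y))" for y v a
    using inexact_gradient_step(2)[OF deriv lip \<Lambda> c C that, of a]
    by (simp add: V_def E_def)

  \<comment> \<open>The perturbations \<open>b1\<close>, \<open>b2\<close>, \<open>b3\<close> come from the summable steps of the line search iterations,
    from the bias of the sampling and from the second order term of the sampling iterations.\<close>
  define u where "u k = expectation (\<lambda>\<omega>. V (x k \<omega>))" for k
  define W where "W k \<omega> = (if m dvd k then \<gamma>0 / real k * (norm (D (x k \<omega>)))\<^sup>2 else 0)" for k \<omega>
  define b1 where "b1 k = (2 * C * E + 2 * \<Lambda> * C\<^sup>2 * E * \<gamma>max) * \<gamma>max * real k powr - (1 + \<delta>)" for k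
  define b2 where "b2 k = 2 * \<gamma>0 * M3 * real N * C * E * real k powr - (1 + \<epsilon>)" for k
  define b3 where "b3 k = 2 * \<Lambda> * C\<^sup>2 * E * \<gamma>0\<^sup>2 * real k powr - 2" for k
  have b_nonneg: "0 \<le> b1 k" "0 \<le> b2 k" "0 \<le> b3 k" for k
    using C E \<Lambda> \<open>1 \<le> \<gamma>max\<close> \<open>\<gamma>0 > 0\<close> A4_constants
    by (auto simp: b1_def b2_def b3_def)
  have b_summable: "summable (\<lambda>k. b1 k + b2 k + b3 k)"
    unfolding b1_def b2_def b3_def using \<open>\<delta> > 0\<close> A4_constants
    by (intro summable_add summable_mult) (auto simp: summable_real_powr_iff)
  have int_W: "integrable M (W k)" for k
    unfolding W_def by (intro int)

  \<comment> \<open>The iterate already depends on the old sample, so the step may go uphill even on average.\<close>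
  have line_search_iteration: "u (Suc k) \<le> u k + b1 k * (1 + u k)" if k: "k \<ge> 1" "\<not> m dvd k" for k
  proof -
    have "V (x (Suc k) \<omega>) \<le> V (x k \<omega>) + b1 k * (1 + V (x k \<omega>))" if \<omega>: "\<omega> \<in> space M" for \<omega>
    proof -
      obtain a where a: "0 \<le> a" "a \<le> \<gamma>max / real k powr (1 + \<delta>)"
        and x: "x (Suc k) \<omega> = x k \<omega> - a *\<^sub>R g k \<omega>"
        unfolding g_def using slises_run_step[OF run[OF \<omega>], of k] k assms(6-8) by (metis order_trans)
      \<comment> \<open>The second order term in \<open>a\<close> is brought to first order by \<open>a \<le> \<gamma>max\<close>.\<close>
      have "\<gamma>max / real k powr (1 + \<delta>) \<le> \<gamma>max / 1"
        using k \<open>1 \<le> \<gamma>max\<close> \<open>\<delta> > 0\<close> by (intro divide_left_mono) (auto simp: ge_one_powr_ge_zero)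
      then have "a * a \<le> \<gamma>max * a"
        using a by (intro mult_right_mono) auto
      then have a2: "a\<^sup>2 \<le> \<gamma>max * a"
        by (simp add: power2_eq_square)
      have inner: "- (D (x k \<omega>) \<bullet> g k \<omega>) \<le> 2 * C * E * (1 + V (x k \<omega>))"
        using inner_bound[OF g_bound[OF \<omega>, of k]] by linarith
      have "V (x (Suc k) \<omega>) \<le> V (x k \<omega>) + a * (- (D (x k \<omega>) \<bullet> g k \<omega>))
          + 2 * \<Lambda> * C\<^sup>2 * E * a\<^sup>2 * (1 + V (x k \<omega>))"
        unfolding x using step_bound[OF g_bound[OF \<omega>, of k], of a] by simp
      also have "\<dots> \<le> V (x k \<omega>) + a * (2 * C * E * (1 + V (x k \<omega>)))
          + 2 * \<Lambda> * C\<^sup>2 * E * (\<gamma>max * a) * (1 + V (x k \<omega>))"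
        using inner a a2 C E \<Lambda> V by (intro add_mono mult_left_mono mult_right_mono) auto
      also have "\<dots> = V (x k \<omega>) + (2 * C * E + 2 * \<Lambda> * C\<^sup>2 * E * \<gamma>max) * a * (1 + V (x k \<omega>))"
        by (simp add: algebra_simps)
      also have "\<dots> \<le> V (x k \<omega>) + (2 * C * E + 2 * \<Lambda> * C\<^sup>2 * E * \<gamma>max)
          * (\<gamma>max * real k powr - (1 + \<delta>)) * (1 + V (x k \<omega>))"
        using a(2) C E \<Lambda> V \<open>1 \<le> \<gamma>max\<close> unfolding divide_inverse powr_minus[symmetric]
        by (intro add_left_mono mult_left_mono mult_right_mono) auto
      finally show ?thesis
        by (simp add: b1_def mult.assoc)
    qed
    then have "u (Suc k) \<le> expectation (\<lambda>\<omega>. V (x k \<omega>) + b1 k * (1 + V (x k \<omega>)))"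
      unfolding u_def by (intro integral_mono int) auto
    also have "\<dots> = u k + b1 k * (1 + u k)"
      using int[of V k] by (simp add: u_def prob_space)
    finally show ?thesis .
  qed

  \<comment> \<open>Here the iterate is fixed by the past and the sample is fresh, so the first order term
    contributes \<open>(\<gamma>0 / k) * (norm (D (x k \<omega>)))\<^sup>2\<close> up to the bias of the sampling.\<close>
  have sampling_iteration: "u (Suc k) \<le> u k - expectation (W k) + (b2 k + b3 k) * (1 + u k)"
    if k: "k \<ge> 1" "m dvd k" for k
  proof -
    define e where "e = M3 / real k powr \<epsilon>"
    define a where "a = \<gamma>0 / real k"
    have e: "e \<ge> 0" and a: "a \<ge> 0"
      using A4_constants \<open>\<gamma>0 > 0\<close> by (auto simp: e_def a_def)
    have close: "AE \<omega> in M. \<bar>conditional_probability M (history M N S i k)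
        (i k l -` {j} \<inter> space M) \<omega> - 1 / real N\<bar> \<le> e" if "l \<in> {1..S}" "j \<in> {1..N}" for l j
    proof -
      have "AE \<omega> in M. conditional_probability M (history M N S i k)
          (i k l -` {j} \<inter> space M) \<omega> = p k j \<omega>"
        using A4_sampling k that unfolding nonuniform_sampling_def by blast
      then show ?thesis
        using A4_bound[OF k that(2)] by eventually_elim (simp add: e_def)
    qed
    have "\<bar>D y \<bullet> gradient (f j) y\<bar> \<le> 2 * C * E * (1 + V y)" if "j \<in> {1..N}" for j y
      using inner_bound[OF grad_bound[OF that]] .
    from sub_gradient_nearly_unbiased[where I = "i k", OF sub \<open>S > 0\<close> e x_history x_finite idx close this[unfolded D_def],
        folded D_def g_def]
    have int_inner: "integrable M (\<lambda>\<omega>. D (x k \<omega>) \<bullet> g k \<omega>)"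
      and inner: "expectation (\<lambda>\<omega>. (norm (D (x k \<omega>)))\<^sup>2)
          - e * real N * expectation (\<lambda>\<omega>. 2 * C * E * (1 + V (x k \<omega>)))
          \<le> expectation (\<lambda>\<omega>. D (x k \<omega>) \<bullet> g k \<omega>)"
      by simp_all
    have "V (x (Suc k) \<omega>) \<le> V (x k \<omega>) - a * (D (x k \<omega>) \<bullet> g k \<omega>) + b3 k * (1 + V (x k \<omega>))"
      if \<omega>: "\<omega> \<in> space M" for \<omega>
    proof -
      have "x (Suc k) \<omega> = x k \<omega> - a *\<^sub>R g k \<omega>"
        using slises_run_step[OF run[OF \<omega>], of k] k assms(6-8) unfolding g_def a_def
        by (metis max.absorb1 order_trans)
      moreover have "2 * \<Lambda> * C\<^sup>2 * E * a\<^sup>2 = b3 k"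
        using k by (simp add: a_def b3_def powr_minus divide_inverse power_mult_distrib power_inverse)
      ultimately show ?thesis
        using step_bound[OF g_bound[OF \<omega>, of k], of a] by simp
    qed
    then have "u (Suc k) \<le> expectation (\<lambda>\<omega>. V (x k \<omega>) - a * (D (x k \<omega>) \<bullet> g k \<omega>) + b3 k * (1 + V (x k \<omega>)))"
      unfolding u_def by (intro integral_mono) (simp_all add: int int_inner)
    also have "\<dots> = u k - a * expectation (\<lambda>\<omega>. D (x k \<omega>) \<bullet> g k \<omega>) + b3 k * (1 + u k)"
      using int[of V k] int_inner by (simp add: u_def prob_space)
    also have "\<dots> \<le> u k - a * (expectation (\<lambda>\<omega>. (norm (D (x k \<omega>)))\<^sup>2)
          - e * real N * (2 * C * E * (1 + u k))) + b3 k * (1 + u k)"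
      using inner a int[of V k]
      by (intro add_right_mono diff_left_mono mult_left_mono) (auto simp: u_def prob_space)
    also have "\<dots> = u k - expectation (W k) + (b2 k + b3 k) * (1 + u k)"
    proof -
      have "expectation (W k) = a * expectation (\<lambda>\<omega>. (norm (D (x k \<omega>)))\<^sup>2)"
        using k by (simp add: W_def[abs_def] a_def)
      moreover have "a * (e * real N * (2 * C * E)) = b2 k"
      proof -
        have "real k powr - (1 + \<epsilon>) = inverse (real k) * inverse (real k powr \<epsilon>)"
          using k by (simp add: powr_minus powr_add del: minus_add_distrib)
        then show ?thesis
          unfolding b2_def by (simp add: a_def e_def divide_inverse mult_ac)
      qed
      ultimately show ?thesis
        by (simp add: algebra_simps)
    qed
    finally show ?thesis .
  qed

  have u_nonneg: "0 \<le> u k" for k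
    unfolding u_def using V by (intro integral_nonneg_AE) auto
  \<comment> \<open>The recursion starts at 1: the bound on the sampling probabilities says nothing about
    iteration 0.\<close>
  have "summable (\<lambda>k. expectation (W (Suc k)))"
  proof (rule perturbed_descent_summable)
    show "0 \<le> u (Suc k)" for k
      by (rule u_nonneg)
    show "0 \<le> expectation (W (Suc k))" for k
      using \<open>\<gamma>0 > 0\<close> by (intro integral_nonneg_AE) (auto simp: W_def)
    show "0 \<le> b1 (Suc k) + b2 (Suc k) + b3 (Suc k)" for k
      using b_nonneg[of "Suc k"] by simp
    show "summable (\<lambda>k. b1 (Suc k) + b2 (Suc k) + b3 (Suc k))"
      using b_summable by (subst summable_Suc_iff)
    show "u (Suc (Suc k)) \<le> u (Suc k) - expectation (W (Suc k))
        + (b1 (Suc k) + b2 (Suc k) + b3 (Suc k)) * (1 + u (Suc k))" for k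
    proof (cases "m dvd Suc k")
      case True
      have "0 \<le> b1 (Suc k) * (1 + u (Suc k))"
        using b_nonneg u_nonneg by (intro mult_nonneg_nonneg add_nonneg_nonneg) auto
      then show ?thesis
        using sampling_iteration[OF _ True] by (simp add: algebra_simps)
    next
      case False
      have "0 \<le> (b2 (Suc k) + b3 (Suc k)) * (1 + u (Suc k))"
        using b_nonneg u_nonneg by (intro mult_nonneg_nonneg add_nonneg_nonneg) auto
      moreover have "expectation (W (Suc k)) = 0"
        using False by (simp add: W_def[abs_def])
      ultimately show ?thesis
        using line_search_iteration[OF _ False] by (simp add: algebra_simps)
    qed
  qed
  then have "summable (\<lambda>k. expectation (W k))"
    by (subst (asm) summable_Suc_iff)
  then have "AE \<omega> in M. summable (\<lambda>k. W k \<omega>)"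
    by (rule AE_summable_if_expectations_summable[OF int_W, rotated])
       (use \<open>\<gamma>0 > 0\<close> in \<open>simp add: W_def\<close>)
  then show ?thesis
  proof eventually_elim
    case (elim \<omega>)
    then show ?case
      unfolding grad W_def
      by (intro liminf_eq_0_of_weighted_squares_summable[OF \<open>m > 0\<close> \<open>\<gamma>0 > 0\<close>]) auto
  qed
qed

end
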